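(* Let $(X,\rho,\mathfrak m)$ be a compact $d$-Ahlfors regular metric measure space of diameter $1$, where $d>0$, and let $B,L>0$. There are constants $\varepsilon_0,c,C>0$ such that: for any $\mathcal F\subseteq\operatorname{Lip}((X,\rho),\mathbb R;L)$ and any $0<\varepsilon<\min\{B/2,L\varepsilon_0\}$, if $$\sup_{f\in\operatorname{Lip}((X,\rho),[-B,B];L)}\ \inf_{\hat f\in\mathcal F}\ \|f-\hat f\|_\infty\le\varepsilon,\qquad(\ast)$$ then $$c\,(L/\varepsilon)^d\ \le\ \operatorname{fat}_\varepsilon(\mathcal F)\ \le\ C\,(L/\varepsilon)^d .$$ In particular, $\mathcal F_{M:L}\subseteq\operatorname{Lip}((X,\rho),\mathbb R;L)$ for every $M\in\mathbb N_+$, and there is a constant $C_d'>0$, depending only on $(X,\rho,\mathfrak m)$, such that $(\ast)$ holds for $\mathcal F=\mathcal F_{M:L}$ whenever $M\ge C_d'(L/\varepsilon)^d$.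
   Context: A metric measure space $(X,\rho,\mathfrak m)$ (a metric space with a Borel measure) is $d$-Ahlfors regular if $\operatorname{supp}(\mathfrak m)=X$ and there are constants $0<c_A\le C_A<\infty$ with $c_A r^d\le\mathfrak m(B(x,r))\le C_A r^d$ for every $x\in X$ and every $0<r\le\operatorname{diam}(X)$, where $B(x,r)$ is the metric ball. For $S\subseteq\mathbb R$, $\operatorname{Lip}((X,\rho),S;L)$ is the set of $L$-Lipschitz functions $f:X\to S$, and $\|\cdot\|_\infty$ is the sup norm on $X$. Fat-shattering dimension: for $\mathcal F\subseteq\mathbb R^X$ and $\gamma>0$, a finite set $\{x_1,\dots,x_m\}\subseteq X$ is $\gamma$-fat shattered by $\mathcal F$ if there are $t_1,\dots,t_m\in\mathbb R$ such that for every $\sigma\in\{-1,1\}^m$ there is $f_\sigma\in\mathcal F$ with $\sigma_j(f_\sigma(x_j)-t_j)\ge\gamma$ for every $j\in\{1,\dots,m\}$. $\operatorname{fat}_\gamma(\mathcal F)$ is the largest such $m$. Central-envelope class: for $M\in\mathbb N_+$ and $\theta=((a_m,b_m,L))_{m=1}^M\in(\mathbb R\times X\times\{L\})^M$, put $$\hat f_\theta(x):=\tfrac12\Big[\min_{1\le m\le M}\{a_m+L\rho(x,b_m)\}+\max_{1\le m\le M}\{a_m-L\rho(x,b_m)\}\Big],\quad x\in X,$$ and $\mathcal F_{M:L}:=\{\hat f_\theta:\theta\in(\mathbb R\times X\times\{L\})^M\}$. *)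

theory Defs
  imports "HOL-Analysis.Analysis"
begin

definition measure_supp :: "'a::metric_space measure \<Rightarrow> 'a set" where
  "measure_supp m = {x. \<forall>U. open U \<and> x \<in> U \<longrightarrow> emeasure m U > 0}"

text \<open>The metric space is the whole type. The library's \<open>diameter\<close> is meaningful only for
  bounded sets; an unbounded space has infinite diameter, so then every radius is admitted.\<close>

definition Ahlfors_regular :: "real \<Rightarrow> 'a::metric_space measure \<Rightarrow> bool" where
  "Ahlfors_regular d m \<longleftrightarrow>
     sets m = sets borel \<and>
     measure_supp m = UNIV \<and>
     (\<exists>cA CA. 0 < cA \<and> cA \<le> CA \<and>
       (\<forall>x r. 0 < r \<and> (bounded (UNIV :: 'a set) \<longrightarrow> r \<le> diameter (UNIV :: 'a set)) \<longrightarrow>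
          ennreal (cA * r powr d) \<le> emeasure m (ball x r) \<and>
          emeasure m (ball x r) \<le> ennreal (CA * r powr d)))"

definition Lip :: "real set \<Rightarrow> real \<Rightarrow> ('a::metric_space \<Rightarrow> real) set" where
  "Lip S L = {f. L-lipschitz_on UNIV f \<and> range f \<subseteq> S}"

definition sup_norm :: "('a \<Rightarrow> real) \<Rightarrow> ereal" where
  "sup_norm f = (SUP x. ereal \<bar>f x\<bar>)"

text \<open>Extended reals make the infimum over an empty class infinite.\<close>

definition approx_error ::
  "('a \<Rightarrow> real) set \<Rightarrow> ('a \<Rightarrow> real) set \<Rightarrow> ereal" where
  "approx_error G F = (SUP f\<in>G. INF g\<in>F. sup_norm (\<lambda>x. f x - g x))"

text \<open>Thresholds and sign patterns are indexed by the points of the shattered set itself;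
  their values off that set are irrelevant.\<close>

definition fat_shattered :: "real \<Rightarrow> ('a \<Rightarrow> real) set \<Rightarrow> 'a set \<Rightarrow> bool" where
  "fat_shattered \<gamma> F A \<longleftrightarrow> finite A \<and>
     (\<exists>t :: 'a \<Rightarrow> real. \<forall>\<sigma> \<in> A \<rightarrow> {-1, 1 :: real}. \<exists>f\<in>F. \<forall>x\<in>A. \<sigma> x * (f x - t x) \<ge> \<gamma>)"

text \<open>Infinite if there are shattered sets of arbitrarily large cardinality.\<close>

definition fat_dim :: "real \<Rightarrow> ('a \<Rightarrow> real) set \<Rightarrow> enat" where
  "fat_dim \<gamma> F = (SUP A \<in> {A. fat_shattered \<gamma> F A}. enat (card A))"

text \<open>A parameter \<open>((a\<^sub>m, b\<^sub>m, L))\<close> with constant last component is given by the two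
  sequences \<open>a\<close>, \<open>b\<close> (of which only the entries \<open>1, \<dots>, M\<close> matter) and \<open>L\<close>.\<close>

definition central_envelope ::
  "real \<Rightarrow> nat \<Rightarrow> (nat \<Rightarrow> real) \<Rightarrow> (nat \<Rightarrow> 'a::metric_space) \<Rightarrow> 'a \<Rightarrow> real" where
  "central_envelope L M a b x =
     1 / 2 * ((MIN m\<in>{1..M}. a m + L * dist x (b m)) + (MAX m\<in>{1..M}. a m - L * dist x (b m)))"

definition central_envelope_class :: "nat \<Rightarrow> real \<Rightarrow> ('a::metric_space \<Rightarrow> real) set" where
  "central_envelope_class M L = {central_envelope L M a b |a b. True}"

end

theory Submission
  imports Defs
begin

text \<open>Volume comparison of balls shows that every \<open>s\<close>-separated set has \<open>O(s\<^sup>-\<^sup>d)\<close> points and every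
  \<open>s\<close>-net at least a constant times \<open>s\<^sup>-\<^sup>d\<close> points. A set that is \<open>\<epsilon>\<close>-fat shattered by \<open>L\<close>-Lipschitz
  functions is \<open>2\<epsilon>/L\<close>-separated, which gives the upper bound. Conversely, on a maximal
  \<open>6\<epsilon>/L\<close>-separated set, every sign pattern with amplitude \<open>\<alpha> = min(B, 3\<epsilon>) > 2\<epsilon>\<close> extends to an
  \<open>L\<close>-Lipschitz function (McShane), and a sufficiently good approximant from the class still
  has margin \<open>\<epsilon>\<close>. Finally, if the centres \<open>b\<^sub>m\<close> contain an \<open>\<epsilon>/L\<close>-net and \<open>a\<^sub>m = f(b\<^sub>m)\<close>, then
  the two envelopes lie within \<open>2\<epsilon>\<close> of \<open>f\<close> on opposite sides, so their mean is within \<open>\<epsilon>\<close>.\<close>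

section \<open>Separated sets, packing and covering bounds\<close>

definition separated :: "real \<Rightarrow> 'a::metric_space set \<Rightarrow> bool" where
  "separated s A \<longleftrightarrow> (\<forall>x\<in>A. \<forall>y\<in>A. x \<noteq> y \<longrightarrow> s \<le> dist x y)"

lemma dist_le_diameter_UNIV:
  fixes x y :: "'a::metric_space"
  assumes "compact (UNIV :: 'a set)"
  shows "dist x y \<le> diameter (UNIV :: 'a set)"
  using diameter_bounded_bound[OF compact_imp_bounded[OF assms]] by simp

text \<open>Finitely many balls of radius 1 cover the compact space, and each has finite mass, so
  the total mass is finite. The volume bounds can then be stated for the real-valued
  \<open>measure\<close>; diameter 1 makes them available for all radii up to 1.\<close>

lemma Ahlfors_regular_unit_diameter:
  fixes m :: "'a::metric_space measure"
  assumes "compact (UNIV :: 'a set)" "diameter (UNIV :: 'a set) = 1" "Ahlfors_regular d m"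
  shows "finite_measure m" and "\<exists>c>0. \<exists>C>0. \<forall>x r. 0 < r \<and> r \<le> 1 \<longrightarrow>
    c * r powr d \<le> measure m (ball x r) \<and> measure m (ball x r) \<le> C * r powr d"
proof -
  obtain c C where sets: "sets m = sets borel" and c: "0 < c" "c \<le> C" and
    bd: "\<And>x r. 0 < r \<Longrightarrow> r \<le> 1 \<Longrightarrow> ennreal (c * r powr d) \<le> emeasure m (ball x r)"
        "\<And>x r. 0 < r \<Longrightarrow> r \<le> 1 \<Longrightarrow> emeasure m (ball x r) \<le> ennreal (C * r powr d)"
    using assms unfolding Ahlfors_regular_def by auto
  have space: "space m = UNIV"
    using sets_eq_imp_space_eq[OF sets] by simp
  obtain T where T: "finite T" "(UNIV :: 'a set) \<subseteq> (\<Union>x\<in>T. ball x 1)"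
    using assms(1) unfolding compact_eq_totally_bounded by (meson zero_less_one)
  have "emeasure m (space m) \<le> emeasure m (\<Union>x\<in>T. ball x 1)"
    using T sets by (intro emeasure_mono) (auto simp: space)
  also have "\<dots> \<le> (\<Sum>x\<in>T. emeasure m (ball x 1))"
    using T sets by (intro emeasure_subadditive_finite) auto
  also have "\<dots> \<le> (\<Sum>x\<in>T. ennreal (C * 1 powr d))"
    using bd(2)[of 1] by (intro sum_mono) auto
  also have "\<dots> < \<infinity>"
    by (simp add: ennreal_mult_less_top of_nat_less_top)
  finally interpret finite_measure m
    by (intro finite_measureI) auto
  have lower: "c * r powr d \<le> measure m (ball x r)" if "0 < r" "r \<le> 1" for x r
    using bd(1)[OF that, of x] c by (simp add: emeasure_eq_measure)
  have upper: "measure m (ball x r) \<le> C * r powr d" if "0 < r" "r \<le> 1" for x r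
    using bd(2)[OF that, of x] c by (simp add: emeasure_eq_measure)
  show "finite_measure m"
    by (rule finite_measure_axioms)
  show "\<exists>c>0. \<exists>C>0. \<forall>x r. 0 < r \<and> r \<le> 1 \<longrightarrow>
      c * r powr d \<le> measure m (ball x r) \<and> measure m (ball x r) \<le> C * r powr d"
    using lower upper c less_le_trans[OF c] by blast
qed

text \<open>Balls of radius \<open>s / 2\<close> around an \<open>s\<close>-separated set are
  disjoint, so their masses add up to at most the total mass \<open>V\<close>; this gives
  \<open>K = V / c * 2 powr d\<close>. Balls of radius \<open>s\<close> around a net cover the
  space, so their masses add up to at least \<open>V\<close>; this gives
  \<open>k = V / C\<close>.\<close>

lemma Ahlfors_regular_packing_covering:
  fixes m :: "'a::metric_space measure"
  assumes "compact (UNIV :: 'a set)" "diameter (UNIV :: 'a set) = 1" "Ahlfors_regular d m"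
  obtains K k where "0 < K" "0 < k"
    "\<And>s (A :: 'a set). \<lbrakk>0 < s; s \<le> 1; finite A; separated s A\<rbrakk> \<Longrightarrow> card A \<le> K * (1 / s) powr d"
    "\<And>s (A :: 'a set). \<lbrakk>0 < s; s \<le> 1; finite A; \<And>x. \<exists>y\<in>A. dist x y < s\<rbrakk>
       \<Longrightarrow> k * (1 / s) powr d \<le> card A"
proof -
  interpret finite_measure m
    by (rule Ahlfors_regular_unit_diameter(1)[OF assms])
  have sets: "sets m = sets borel"
    using assms(3) by (simp add: Ahlfors_regular_def)
  obtain c C where c: "0 < c" "0 < C" and
    bounds: "\<forall>x r. 0 < r \<and> r \<le> 1 \<longrightarrow>
      c * r powr d \<le> measure m (ball x r) \<and> measure m (ball x r) \<le> C * r powr d"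
    using Ahlfors_regular_unit_diameter(2)[OF assms] by (elim exE conjE)
  then have lower: "c * r powr d \<le> measure m (ball x r)"
    and upper: "measure m (ball x r) \<le> C * r powr d" if "0 < r" "r \<le> 1" for x r
    using that by simp_all
  define V where "V = measure m UNIV"
  have ball_V: "measure m (ball x r) \<le> V" for x r
    unfolding V_def using sets by (intro finite_measure_mono) auto
  \<comment> \<open>Any ball of radius 1 witnesses that \<open>V\<close> is positive, hence so are
    \<open>K\<close> and \<open>k\<close>.\<close>
  have "0 < c * 1 powr d"
    using c by simp
  also have "\<dots> \<le> V"
    using order_trans[OF lower ball_V, of 1] by simp
  finally have V: "0 < V" .
  show thesis
  proof (rule that)
    show "0 < V / c * 2 powr d" "0 < V / C"
      using V c by simp_all
  next
    fix s :: real and A :: "'a set"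
    assume s: "0 < s" "s \<le> 1" and A: "finite A" "separated s A"
    have disj: "disjoint_family_on (\<lambda>x. ball x (s / 2)) A"
      unfolding disjoint_family_on_def
    proof (intro ballI impI)
      fix x y assume "x \<in> A" "y \<in> A" "x \<noteq> y"
      then have "s / 2 + s / 2 \<le> dist x y"
        using A(2) by (simp add: separated_def)
      then show "ball x (s / 2) \<inter> ball y (s / 2) = {}"
        by (rule disjoint_ballI)
    qed
    have "(\<Sum>x\<in>A. measure m (ball x (s / 2))) = measure m (\<Union>x\<in>A. ball x (s / 2))"
      by (rule finite_measure_finite_Union[OF A(1) _ disj, symmetric]) (simp add: sets image_subset_iff)
    also have "\<dots> \<le> V"
      unfolding V_def using sets by (intro finite_measure_mono) auto
    finally have "(\<Sum>x\<in>A. c * (s / 2) powr d) \<le> V"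
      using s sum_mono[of A "\<lambda>_. c * (s / 2) powr d" "\<lambda>x. measure m (ball x (s / 2))"] lower[of "s / 2"]
      by simp
    then show "card A \<le> V / c * 2 powr d * (1 / s) powr d"
      using s c by (simp add: powr_divide field_simps)
  next
    fix s :: real and A :: "'a set"
    assume s: "0 < s" "s \<le> 1" and A: "finite A" "\<And>x. \<exists>y\<in>A. dist x y < s"
    have "V \<le> measure m (\<Union>x\<in>A. ball x s)"
      unfolding V_def using A sets
      by (intro finite_measure_mono) (auto simp: dist_commute)
    also have "\<dots> \<le> (\<Sum>x\<in>A. measure m (ball x s))"
      using A sets by (intro finite_measure_subadditive_finite) auto
    also have "\<dots> \<le> (\<Sum>x\<in>A. C * s powr d)"
      using s upper by (intro sum_mono) auto
    finally show "V / C * (1 / s) powr d \<le> card A"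
      using s c by (simp add: powr_divide field_simps)
  qed
qed

text \<open>A separated set of maximal cardinality is a net.\<close>

lemma exists_separated_net:
  fixes N :: nat
  assumes "\<And>A :: 'a::metric_space set. finite A \<Longrightarrow> separated s A \<Longrightarrow> card A \<le> N" and "0 < s"
  obtains A :: "'a::metric_space set" where "finite A" "separated s A" "\<And>x. \<exists>y\<in>A. dist x y < s"
proof -
  obtain A :: "'a set" where A: "finite A" "separated s A"
    and max: "\<And>A' :: 'a set. finite A' \<and> separated s A' \<Longrightarrow> card A' \<le> card A"
    using ex_has_greatest_nat[of "\<lambda>A :: 'a set. finite A \<and> separated s A" "{}" card "Suc N"] assms(1)
    by (auto simp: separated_def less_Suc_eq_le)
  have "\<exists>y\<in>A. dist x y < s" for x
  proof (rule ccontr)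
    assume *: "\<not> (\<exists>y\<in>A. dist x y < s)"
    then have "x \<notin> A"
      using \<open>0 < s\<close> by auto
    moreover have "separated s (insert x A)"
      using * A(2) by (auto simp: separated_def dist_commute not_less)
    ultimately show False
      using max[of "insert x A"] A(1) by simp
  qed
  with A that show thesis
    by blast
qed

section \<open>Lipschitz functions and minima or maxima of cones\<close>

lemma lipschitz_on_realI:
  fixes f :: "'a::metric_space \<Rightarrow> real"
  assumes "\<And>x y. f x \<le> f y + L * dist x y" "0 \<le> L"
  shows "L-lipschitz_on UNIV f"
proof (rule lipschitz_onI)
  fix x y
  show "dist (f x) (f y) \<le> L * dist x y"
    using assms(1)[of x y] assms(1)[of y x] by (simp add: dist_real_def dist_commute abs_le_iff)
qed fact

lemma lipschitz_on_realD:
  fixes f :: "'a::metric_space \<Rightarrow> real"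
  assumes "L-lipschitz_on UNIV f"
  shows "f x \<le> f y + L * dist x y"
  using lipschitz_onD[OF assms, of x y] by (simp add: dist_real_def abs_le_iff)

text \<open>The index attaining the minimum at \<open>y\<close> is a competitor at \<open>x\<close>,
  and the triangle inequality compares the two cone values. The index type is arbitrary so that the
  result serves both the central envelope and the McShane extension.\<close>

lemma Min_cone_le:
  fixes a :: "'b \<Rightarrow> real"
  assumes "finite I" "I \<noteq> {}" "0 \<le> L"
  shows "(MIN i\<in>I. a i + L * dist x (b i)) \<le> (MIN i\<in>I. a i + L * dist y (b i)) + L * dist x y"
proof -
  have "(MIN i\<in>I. a i + L * dist y (b i)) \<in> (\<lambda>i. a i + L * dist y (b i)) ` I"
    using assms by (intro Min_in) auto
  then obtain i where i: "i \<in> I" "(MIN i\<in>I. a i + L * dist y (b i)) = a i + L * dist y (b i)"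
    by auto
  have "(MIN i\<in>I. a i + L * dist x (b i)) \<le> a i + L * dist x (b i)"
    using assms i by (intro Min_le) auto
  also have "\<dots> \<le> a i + L * (dist x y + dist y (b i))"
    using assms by (intro add_left_mono mult_left_mono dist_triangle) auto
  finally show ?thesis
    using i by (simp add: algebra_simps)
qed

text \<open>Dual argument: the index attaining the maximum at \<open>x\<close> is a competitor at
  \<open>y\<close>.\<close>

lemma Max_cone_le:
  fixes a :: "'b \<Rightarrow> real"
  assumes "finite I" "I \<noteq> {}" "0 \<le> L"
  shows "(MAX i\<in>I. a i - L * dist x (b i)) \<le> (MAX i\<in>I. a i - L * dist y (b i)) + L * dist x y"
proof -
  have "(MAX i\<in>I. a i - L * dist x (b i)) \<in> (\<lambda>i. a i - L * dist x (b i)) ` I"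
    using assms by (intro Max_in) auto
  then obtain i where i: "i \<in> I" "(MAX i\<in>I. a i - L * dist x (b i)) = a i - L * dist x (b i)"
    by auto
  have "a i - L * (dist x y + dist x (b i)) \<le> a i - L * dist y (b i)"
    using assms dist_triangle[of y "b i" x] by (intro diff_left_mono mult_left_mono) (auto simp: dist_commute)
  also have "\<dots> \<le> (MAX i\<in>I. a i - L * dist y (b i))"
    using assms i by (intro Max_ge) auto
  finally show ?thesis
    using i by (simp add: algebra_simps)
qed

text \<open>The mean of two \<open>L\<close>-Lipschitz functions is \<open>L\<close>-Lipschitz;
  \<open>M \<ge> 1\<close> ensures that the minimum and maximum range over a nonempty set.\<close>

lemma central_envelope_class_subset_Lip:
  assumes "M \<ge> 1" "0 \<le> L"
  shows "central_envelope_class M L \<subseteq> Lip UNIV L"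
proof
  fix f :: "'a \<Rightarrow> real"
  assume "f \<in> central_envelope_class M L"
  then obtain a b where f: "f = central_envelope L M a b"
    by (auto simp: central_envelope_class_def)
  have "L-lipschitz_on UNIV f"
  proof (rule lipschitz_on_realI)
    fix x y
    have "{1..M} \<noteq> {}"
      using assms by auto
    note bounds = Min_cone_le[OF finite_atLeastAtMost this assms(2)]
      Max_cone_le[OF finite_atLeastAtMost this assms(2)]
    have mean: "1 / 2 * (p + q) \<le> 1 / 2 * (p' + q') + r" if "p \<le> p' + r" "q \<le> q' + r" for p q p' q' r :: real
      using that by argo
    show "f x \<le> f y + L * dist x y"
      unfolding f central_envelope_def by (rule mean[OF bounds])
  qed fact
  then show "f \<in> Lip UNIV L"
    by (simp add: Lip_def)
qed

section \<open>Uniform approximation, and its achievement by central envelopes\<close>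

lemma sup_norm_le_iff: "sup_norm f \<le> ereal e \<longleftrightarrow> (\<forall>x. \<bar>f x\<bar> \<le> e)"
  by (simp add: sup_norm_def SUP_le_iff)

lemma approx_error_leI:
  assumes "\<And>f. f \<in> G \<Longrightarrow> \<exists>g\<in>F. \<forall>x. \<bar>f x - g x\<bar> \<le> e"
  shows "approx_error G F \<le> ereal e"
  unfolding approx_error_def
proof (rule SUP_least)
  fix f assume "f \<in> G"
  then obtain g where "g \<in> F" "\<forall>x. \<bar>f x - g x\<bar> \<le> e"
    using assms by blast
  then show "(INF g\<in>F. sup_norm (\<lambda>x. f x - g x)) \<le> ereal e"
    by (intro INF_lower2[of g]) (simp_all add: sup_norm_le_iff)
qed

text \<open>The infimum over \<open>F\<close> need not be attained, so an actual approximant is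
  obtained only at a tolerance \<open>e'\<close> strictly above \<open>e\<close>.\<close>

lemma approx_errorD:
  assumes "approx_error G F \<le> ereal e" "f \<in> G" "e < e'"
  obtains g where "g \<in> F" "\<And>x. \<bar>f x - g x\<bar> \<le> e'"
proof -
  have "(INF g\<in>F. sup_norm (\<lambda>x. f x - g x)) \<le> approx_error G F"
    unfolding approx_error_def by (rule SUP_upper) fact
  also have "\<dots> < ereal e'"
    using assms by (metis ereal_less_eq(3) le_less_trans less_ereal.simps(1))
  finally obtain g where g: "g \<in> F" "sup_norm (\<lambda>x. f x - g x) < ereal e'"
    by (auto simp: INF_less_iff)
  then have "\<bar>f x - g x\<bar> \<le> e'" for x
    using sup_norm_le_iff[of "\<lambda>x. f x - g x" e'] less_imp_le by blast
  with g(1) that show thesis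
    by blast
qed

lemma approx_error_central_envelope_le:
  fixes A :: "'a::metric_space set"
  assumes A: "finite A" "A \<noteq> {}" "card A \<le> M" "\<And>x. \<exists>y\<in>A. dist x y \<le> \<epsilon> / L" and "0 < L"
  shows "approx_error (Lip S L) (central_envelope_class M L :: ('a \<Rightarrow> real) set) \<le> ereal \<epsilon>"
proof (rule approx_error_leI)
  fix f :: "'a \<Rightarrow> real" assume "f \<in> Lip S L"
  then have lip: "f x \<le> f y + L * dist x y" for x y
    using lipschitz_on_realD by (auto simp: Lip_def)
  \<comment> \<open>The values of \<open>b\<close> at indices beyond \<open>card A\<close> are
    arbitrary. They do no harm: each apex value is \<open>f (b i)\<close>, so by the Lipschitz bound
    every upward cone stays above \<open>f\<close> and every downward cone below it.\<close>
  obtain b where "bij_betw b {1..card A} A"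
    using ex_bij_betw_nat_finite_1[OF A(1)] by blast
  then have "A = b ` {1..card A}"
    by (simp add: bij_betw_imp_surj_on)
  also have "\<dots> \<subseteq> b ` {1..M}"
    using A(3) by (intro image_mono) simp
  finally have b: "A \<subseteq> b ` {1..M}" .
  then have I: "{1..M} \<noteq> {}"
    using A(2) by blast
  define u where "u x = (MIN i\<in>{1..M}. f (b i) + L * dist x (b i))" for x
  define l where "l x = (MAX i\<in>{1..M}. f (b i) - L * dist x (b i))" for x
  have "\<bar>f x - central_envelope L M (f \<circ> b) b x\<bar> \<le> \<epsilon>" for x
  proof -
    obtain y where "y \<in> A" "dist x y \<le> \<epsilon> / L"
      using A(4) by blast
    then obtain i where i: "i \<in> {1..M}" "L * dist x (b i) \<le> \<epsilon>"
      using b \<open>0 < L\<close> by (auto simp: field_simps)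
    have env: "u x \<le> f (b i) + L * dist x (b i)" "f (b i) - L * dist x (b i) \<le> l x"
      unfolding u_def l_def using i by (auto intro!: Min_le Max_ge)
    have lip': "f x \<le> f (b j) + L * dist x (b j)" "f (b j) - L * dist x (b j) \<le> f x" for j
      using lip[of x "b j"] lip[of "b j" x] by (simp_all add: dist_commute)
    have env': "f x \<le> u x" "l x \<le> f x"
      unfolding u_def l_def using I lip' by simp_all
    have "central_envelope L M (f \<circ> b) b x = (u x + l x) / 2"
      by (simp add: central_envelope_def u_def l_def)
    \<comment> \<open>Passing from \<open>f x\<close> to \<open>f (b i)\<close> and then along the
      cone costs \<open>L * dist x (b i)\<close> twice, so
      \<open>u x \<le> f x + 2 * \<epsilon>\<close>; with \<open>l x \<le> f x\<close> the mean
      exceeds \<open>f x\<close> by at most \<epsilon>. The lower bound is symmetric.\<close>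
    then show ?thesis
      using env env' i(2) lip'[of i] by (simp only: abs_le_iff) argo
  qed
  then show "\<exists>g\<in>central_envelope_class M L. \<forall>x. \<bar>f x - g x\<bar> \<le> \<epsilon>"
    by (auto simp: central_envelope_class_def)
qed

section \<open>Fat shattering versus separation\<close>

lemma fat_shattered_imp_separated:
  assumes F: "F \<subseteq> Lip UNIV L" and "fat_shattered \<epsilon> F A" and "0 < L"
  shows "separated (2 * \<epsilon> / L) A"
proof -
  obtain t where t: "\<And>\<sigma>. \<sigma> \<in> A \<rightarrow> {-1, 1 :: real} \<Longrightarrow> \<exists>f\<in>F. \<forall>x\<in>A. \<sigma> x * (f x - t x) \<ge> \<epsilon>"
    using assms(2) by (auto simp: fat_shattered_def)
  have *: "2 * \<epsilon> / L \<le> dist x y" if xy: "x \<in> A" "y \<in> A" "x \<noteq> y" "t y \<le> t x" for x y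
  proof -
    \<comment> \<open>The pattern is positive only at \<open>x\<close>, the point with the larger
      threshold, so \<open>f\<close> must drop by at least \<open>2 * \<epsilon>\<close> from
      \<open>x\<close> to \<open>y\<close>.\<close>
    obtain f where f: "f \<in> F" "\<forall>z\<in>A. (if z = x then 1 else -1) * (f z - t z) \<ge> \<epsilon>"
      using t[of "\<lambda>z. if z = x then 1 else -1"] by auto
    have "f x \<ge> t x + \<epsilon>" "f y \<le> t y - \<epsilon>"
      using f(2)[rule_format, OF xy(1)] f(2)[rule_format, OF xy(2)] xy(3) by auto
    moreover have "f x \<le> f y + L * dist x y"
      using f(1) F lipschitz_on_realD[of L f] by (auto simp: Lip_def)
    ultimately have "2 * \<epsilon> \<le> L * dist x y"
      using xy(4) by linarith
    then show ?thesis
      using \<open>0 < L\<close> by (simp add: field_simps)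
  qed
  show ?thesis
    unfolding separated_def using * by (metis dist_commute linear)
qed

lemma separated_sign_extension:
  fixes A :: "'a::metric_space set"
  assumes A: "finite A" "A \<noteq> {}" "separated s A" and \<sigma>: "\<sigma> \<in> A \<rightarrow> {-1, 1 :: real}"
    and "0 \<le> \<alpha>" "2 * \<alpha> \<le> L * s" "0 \<le> L"
  obtains f where "f \<in> Lip {-\<alpha>..\<alpha>} L" "\<And>x. x \<in> A \<Longrightarrow> f x = \<alpha> * \<sigma> x"
proof -
  have \<sigma>_bd: "-\<alpha> \<le> \<alpha> * \<sigma> y" "\<alpha> * \<sigma> y \<le> \<alpha>" if "y \<in> A" for y
    using \<sigma> that \<open>0 \<le> \<alpha>\<close> by (auto dest!: funcset_mem)
  \<comment> \<open>This is the McShane extension of \<open>\<alpha> * \<sigma>\<close>. It is never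
    below \<open>-\<alpha>\<close>, so only truncation from above remains.\<close>
  define g where "g x = (MIN y\<in>A. \<alpha> * \<sigma> y + L * dist x y)" for x
  define f where "f x = min \<alpha> (g x)" for x
  have "f x \<le> f y + L * dist x y" for x y
    using Min_cone_le[OF A(1,2), of L "\<lambda>y. \<alpha> * \<sigma> y" x "\<lambda>y. y" y] \<open>0 \<le> L\<close> unfolding f_def g_def
    by (smt (verit) mult_nonneg_nonneg zero_le_dist)
  then have "L-lipschitz_on UNIV f"
    using \<open>0 \<le> L\<close> by (rule lipschitz_on_realI)
  moreover have "-\<alpha> \<le> g x" for x
    unfolding g_def using A \<sigma>_bd(1) \<open>0 \<le> L\<close>
    by (auto simp: Min_ge_iff intro: add_increasing2)
  then have "range f \<subseteq> {-\<alpha>..\<alpha>}"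
    using \<open>0 \<le> \<alpha>\<close> by (auto simp: f_def)
  ultimately have "f \<in> Lip {-\<alpha>..\<alpha>} L"
    by (simp add: Lip_def)
  moreover have "f x = \<alpha> * \<sigma> x" if "x \<in> A" for x
  proof -
    have "\<alpha> * \<sigma> x \<le> \<alpha> * \<sigma> y + L * dist x y" if "y \<in> A" for y
    proof (cases "x = y")
      case False
      \<comment> \<open>Prescribed values differ by at most \<open>2 * \<alpha> \<le> L * s\<close>,
        so the cone from another point of \<open>A\<close> cannot undercut the value at
        \<open>x\<close>.\<close>
      then have "L * s \<le> L * dist x y"
        using A(3) \<open>x \<in> A\<close> that \<open>0 \<le> L\<close> by (auto simp: separated_def intro: mult_left_mono)
      then show ?thesis
        using \<sigma>_bd(2)[OF \<open>x \<in> A\<close>] \<sigma>_bd(1)[OF that] \<open>2 * \<alpha> \<le> L * s\<close> by linarith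
    qed simp
    moreover have "g x \<le> \<alpha> * \<sigma> x + L * dist x x"
      unfolding g_def using A(1) \<open>x \<in> A\<close> by (intro Min_le finite_imageI imageI)
    moreover from calculation(1) have "\<alpha> * \<sigma> x \<le> g x"
      using A by (simp add: g_def Min_ge_iff)
    ultimately have "g x = \<alpha> * \<sigma> x"
      by simp
    then show ?thesis
      using \<sigma>_bd(2)[OF that] by (simp add: f_def)
  qed
  ultimately show thesis
    by (rule that)
qed

lemma separated_imp_fat_shattered:
  fixes A :: "'a::metric_space set"
  assumes A: "finite A" "A \<noteq> {}" "separated (6 * \<epsilon> / L) A"
    and err: "approx_error (Lip {-B..B} L) F \<le> ereal \<epsilon>"
    and "0 < \<epsilon>" "2 * \<epsilon> < B" "0 < L"
  shows "fat_shattered \<epsilon> F A"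
proof -
  \<comment> \<open>The bound \<open>3 * \<epsilon>\<close> is what separation
    \<open>6 * \<epsilon> / L\<close> permits, and \<open>B\<close> keeps the extension in the
    approximated class. Since \<open>\<alpha> > 2 * \<epsilon>\<close>, the tolerance
    \<open>\<alpha> - \<epsilon>\<close> strictly exceeds \<epsilon>, as extracting an approximant
    requires.\<close>
  define \<alpha> where "\<alpha> = min B (3 * \<epsilon>)"
  have \<alpha>: "2 * \<epsilon> < \<alpha>" "\<alpha> \<le> B" "\<alpha> \<le> 3 * \<epsilon>"
    using assms by (auto simp: \<alpha>_def)
  have "\<exists>g\<in>F. \<forall>x\<in>A. \<sigma> x * (g x - 0) \<ge> \<epsilon>" if \<sigma>: "\<sigma> \<in> A \<rightarrow> {-1, 1 :: real}" for \<sigma>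
  proof -
    obtain f where f: "f \<in> Lip {-\<alpha>..\<alpha>} L" "\<And>x. x \<in> A \<Longrightarrow> f x = \<alpha> * \<sigma> x"
      using separated_sign_extension[OF A \<sigma>, of \<alpha> L] \<alpha> assms by auto
    then have "f \<in> Lip {-B..B} L"
      using \<alpha>(2) by (fastforce simp: Lip_def)
    then obtain g where g: "g \<in> F" "\<And>x. \<bar>f x - g x\<bar> \<le> \<alpha> - \<epsilon>"
      using approx_errorD[OF err, of f "\<alpha> - \<epsilon>"] \<alpha>(1) by auto
    \<comment> \<open>The margin left is
      \<open>\<alpha> - (\<alpha> - \<epsilon>) = \<epsilon>\<close>, with all thresholds
      zero.\<close>
    have "\<sigma> x * (g x - 0) \<ge> \<epsilon>" if "x \<in> A" for x
      using g(2)[of x] f(2)[OF that] funcset_mem[OF \<sigma> that] by auto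
    with g(1) show ?thesis
      by blast
  qed
  then show ?thesis
    unfolding fat_shattered_def using A(1) by (intro conjI exI[of _ "\<lambda>_. 0"]) auto
qed

text \<open>The supremum is taken in \<open>enat\<close>, so the real bound is first rounded down to
  a natural number, which loses nothing for cardinalities.\<close>

lemma fat_dim_le:
  assumes "\<And>A. fat_shattered \<gamma> F A \<Longrightarrow> real (card A) \<le> K" "0 \<le> K"
  shows "ereal_of_enat (fat_dim \<gamma> F) \<le> ereal K"
proof -
  have "real (card A) \<le> K \<Longrightarrow> card A \<le> nat \<lfloor>K\<rfloor>" for A :: "'a set"
    by (simp add: le_nat_floor)
  then have "fat_dim \<gamma> F \<le> enat (nat \<lfloor>K\<rfloor>)"
    unfolding fat_dim_def using assms by (auto intro!: SUP_least)
  then have "ereal_of_enat (fat_dim \<gamma> F) \<le> ereal_of_enat (enat (nat \<lfloor>K\<rfloor>))"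
    by (simp only: ereal_of_enat_le_iff)
  also have "\<dots> \<le> ereal K"
    using of_nat_floor[OF \<open>0 \<le> K\<close>] by simp
  finally show ?thesis .
qed

section \<open>Combining the bounds and fixing the constants\<close>

theorem theorem4p6:
  fixes m :: "'a::metric_space measure" and d :: real
  assumes "compact (UNIV :: 'a set)"
    and "diameter (UNIV :: 'a set) = 1"
    and "d > 0"
    and "Ahlfors_regular d m"
  shows "\<exists>C'>0. \<forall>B>0. \<forall>L>0.
    (\<exists>\<epsilon>\<^sub>0>0. \<exists>c>0. \<exists>C>0. \<forall>F \<subseteq> (Lip UNIV L :: ('a \<Rightarrow> real) set). \<forall>\<epsilon>.
       0 < \<epsilon> \<and> \<epsilon> < min (B / 2) (L * \<epsilon>\<^sub>0) \<and> approx_error (Lip {-B..B} L) F \<le> ereal \<epsilon> \<longrightarrow>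
         ereal (c * (L / \<epsilon>) powr d) \<le> ereal_of_enat (fat_dim \<epsilon> F) \<and>
         ereal_of_enat (fat_dim \<epsilon> F) \<le> ereal (C * (L / \<epsilon>) powr d)) \<and>
    (\<forall>M::nat. M \<ge> 1 \<longrightarrow> central_envelope_class M L \<subseteq> (Lip UNIV L :: ('a \<Rightarrow> real) set)) \<and>
    (\<forall>(M::nat) \<epsilon>. M \<ge> 1 \<and> \<epsilon> > 0 \<and> real M \<ge> C' * (L / \<epsilon>) powr d \<longrightarrow>
       approx_error (Lip {-B..B} L) (central_envelope_class M L :: ('a \<Rightarrow> real) set) \<le> ereal \<epsilon>)"
proof -
  obtain K k where "0 < K" "0 < k" and
    pack: "\<And>s (A :: 'a set). \<lbrakk>0 < s; s \<le> 1; finite A; separated s A\<rbrakk> \<Longrightarrow> card A \<le> K * (1 / s) powr d"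
    and cover: "\<And>s (A :: 'a set). \<lbrakk>0 < s; s \<le> 1; finite A; \<And>x. \<exists>y\<in>A. dist x y < s\<rbrakk>
       \<Longrightarrow> k * (1 / s) powr d \<le> card A"
    using Ahlfors_regular_packing_covering[OF assms(1,2,4)] by blast
  have net: "\<exists>A :: 'a set. finite A \<and> separated s A \<and> (\<forall>x. \<exists>y\<in>A. dist x y < s)"
    if s: "0 < s" "s \<le> 1" for s
    using exists_separated_net[of s "nat \<lfloor>K * (1 / s) powr d\<rfloor>"] pack[OF s] s(1)
    by (metis le_nat_floor)
  have bounds: "ereal (k / 6 powr d * (L / \<epsilon>) powr d) \<le> ereal_of_enat (fat_dim \<epsilon> F) \<and>
      ereal_of_enat (fat_dim \<epsilon> F) \<le> ereal (K * (L / \<epsilon>) powr d)"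
    if "0 < L" and F: "F \<subseteq> Lip UNIV L" and \<epsilon>: "0 < \<epsilon>" "\<epsilon> < min (B / 2) (L * (1 / 6))"
      and err: "approx_error (Lip {-B..B} L) F \<le> ereal \<epsilon>" for B L \<epsilon> and F :: "('a \<Rightarrow> real) set"
  proof
    \<comment> \<open>The choice \<open>1 / 6\<close> for the threshold constant keeps this scale
      within the range of radii where the volume bounds hold.\<close>
    have s: "0 < 6 * \<epsilon> / L" "6 * \<epsilon> / L \<le> 1"
      using \<epsilon> \<open>0 < L\<close> by (auto simp: field_simps)
    obtain A :: "'a set" where A: "finite A" "separated (6 * \<epsilon> / L) A"
        "\<And>x. \<exists>y\<in>A. dist x y < 6 * \<epsilon> / L"
      using net[OF s] by blast
    have "fat_shattered \<epsilon> F A"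
      using A err \<epsilon> \<open>0 < L\<close> by (intro separated_imp_fat_shattered[of A \<epsilon> L B F]) auto
    then have "ereal_of_enat (enat (card A)) \<le> ereal_of_enat (fat_dim \<epsilon> F)"
      unfolding ereal_of_enat_le_iff fat_dim_def by (intro SUP_upper) simp
    moreover have "k / 6 powr d * (L / \<epsilon>) powr d \<le> card A"
      using cover[OF s A(1,3)] \<epsilon> \<open>0 < L\<close> by (simp add: powr_divide powr_mult)
    ultimately show "ereal (k / 6 powr d * (L / \<epsilon>) powr d) \<le> ereal_of_enat (fat_dim \<epsilon> F)"
      by (metis ereal_less_eq(3) ereal_of_enat_simps(1) order_trans)
  next
    have s: "0 < 2 * \<epsilon> / L" "2 * \<epsilon> / L \<le> 1"
      using \<epsilon> \<open>0 < L\<close> by (auto simp: field_simps)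
    show "ereal_of_enat (fat_dim \<epsilon> F) \<le> ereal (K * (L / \<epsilon>) powr d)"
    proof (rule fat_dim_le)
      fix A assume A: "fat_shattered \<epsilon> F A"
      have "card A \<le> K * (1 / (2 * \<epsilon> / L)) powr d"
        using A fat_shattered_imp_separated[OF F A \<open>0 < L\<close>]
        by (intro pack[OF s]) (auto simp: fat_shattered_def)
      \<comment> \<open>The factor \<open>1 / 2\<close> inside the power is dropped, which is
        monotone because \<open>d > 0\<close>.\<close>
      also have "\<dots> \<le> K * (L / \<epsilon>) powr d"
        using \<open>0 < K\<close> \<open>0 < L\<close> \<open>d > 0\<close> \<epsilon> by (intro mult_left_mono powr_mono2) (auto simp: field_simps)
      finally show "card A \<le> K * (L / \<epsilon>) powr d" .
    qed (use \<open>0 < K\<close> in simp)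
  qed
  have envelope: "approx_error (Lip {-B..B} L) (central_envelope_class M L :: ('a \<Rightarrow> real) set) \<le> ereal \<epsilon>"
    if "0 < L" "M \<ge> 1" "\<epsilon> > 0" and M: "real M \<ge> K * (L / \<epsilon>) powr d" for B L \<epsilon> :: real and M :: nat
  proof (cases "\<epsilon> / L \<le> 1")
    case True
    then obtain A :: "'a set" where A: "finite A" "separated (\<epsilon> / L) A" "\<And>x. \<exists>y\<in>A. dist x y < \<epsilon> / L"
      using net[OF _ True] \<open>0 < L\<close> \<open>\<epsilon> > 0\<close> by (metis divide_pos_pos)
    have "real (card A) \<le> M"
      using pack[OF _ True A(1,2)] that by simp
    with A \<open>0 < L\<close> show ?thesis
      by (intro approx_error_central_envelope_le[of A]) (auto intro: less_imp_le)
  next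
    \<comment> \<open>Here \<epsilon> exceeds \<open>L\<close>, beyond the reach of the packing
      bound; as the diameter is 1, any single point is already a net and \<open>M \<ge> 1\<close>
      suffices.\<close>
    case False
    have "dist x y \<le> \<epsilon> / L" for x y :: 'a
      using dist_le_diameter_UNIV[OF assms(1), of x y] assms(2) False by simp
    then show ?thesis
      using that by (intro approx_error_central_envelope_le[of "{undefined}"]) auto
  qed
  show ?thesis
  \<comment> \<open>The packing constant \<open>K\<close> serves both as \<open>C'\<close> and as
    the upper constant \<open>C\<close>. It is fixed before \<open>B\<close> and \<open>L\<close>,
    so it depends only on the space, its measure and \<open>d\<close>.\<close>
  proof (rule exI[of _ K], intro conjI allI impI)
    fix B L :: real assume "0 < B" "0 < L"
    show "\<exists>\<epsilon>\<^sub>0>0. \<exists>c>0. \<exists>C>0. \<forall>F \<subseteq> (Lip UNIV L :: ('a \<Rightarrow> real) set). \<forall>\<epsilon>.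
       0 < \<epsilon> \<and> \<epsilon> < min (B / 2) (L * \<epsilon>\<^sub>0) \<and> approx_error (Lip {-B..B} L) F \<le> ereal \<epsilon> \<longrightarrow>
         ereal (c * (L / \<epsilon>) powr d) \<le> ereal_of_enat (fat_dim \<epsilon> F) \<and>
         ereal_of_enat (fat_dim \<epsilon> F) \<le> ereal (C * (L / \<epsilon>) powr d)"
    proof (rule exI[of _ "1 / 6"], rule conjI[rotated], rule exI[of _ "k / 6 powr d"],
        rule conjI[rotated], rule exI[of _ K], intro conjI allI impI)
    qed (use bounds[OF \<open>0 < L\<close>] \<open>0 < K\<close> \<open>0 < k\<close> in auto)
  qed (use \<open>0 < K\<close> central_envelope_class_subset_Lip[OF _ less_imp_le] envelope in blast)+
qed

end
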